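(* Let $T$ be a full binary tree with leaves indexed $1,\dots,k$ and set of internal nodes $\operatorname{int}(T)$. For each internal node $v$ let $\mathcal L(v)$ be the set of leaves below $v$, let $b_v\in\{0,1\}^k$ be the indicator vector of $\mathcal L(v)$, and define the $k\times k$ matrix $$K_T=\sum_{v\in\operatorname{int}(T)}b_vb_v^\top,\qquad (K_T)_{ij}=\#\{v\in\operatorname{int}(T): i,j\in\mathcal L(v)\}.$$ For $p=(p_1,\dots,p_k)^\top\in\mathbb R^k$ and $q_v=\sum_{i\in\mathcal L(v)}p_i$, $$\sum_{v\in\operatorname{int}(T)}q_v^2=p^\top K_Tp.$$ If $p$ is a random vector with second-moment matrix $M=\mathbb E_p[pp^\top]$, then $$\mathbb E_p\Bigl[\sum_{v\in\operatorname{int}(T)}q_v^2\Bigr]=\operatorname{tr}(K_TM)=\langle K_T,M\rangle.$$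
   Context: A full binary tree is one in which every internal node has exactly two children. $\langle X,Y\rangle=\operatorname{tr}(X^\top Y)$ is the Frobenius inner product. The entries of the second-moment matrix $M$ are assumed to exist (finite second moments). *)

theory Defs
  imports "HOL-Probability.Probability"
begin

text \<open>
  Rooted binary trees in which every internal node has exactly two children, with labelled
  leaves. The one-leaf tree, which has no internal node, is included.
\<close>

datatype 'k full_tree = Leaf 'k | Node "'k full_tree" "'k full_tree"

fun leaf_list :: "'k full_tree \<Rightarrow> 'k list" where
  "leaf_list (Leaf i) = [i]"
| "leaf_list (Node l r) = leaf_list l @ leaf_list r"

text \<open>
  The leaves are in bijection with the index type \<open>'k\<close>, which plays the role of \<open>{1, \<dots>, k}\<close>:
  every index labels exactly one leaf, and a leaf is identified with its index.
\<close>

definition leaf_indexed :: "'k full_tree \<Rightarrow> bool" where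
  "leaf_indexed T \<longleftrightarrow> distinct (leaf_list T) \<and> set (leaf_list T) = UNIV"

text \<open>
  A node is represented by its address, the path that leads to it from the root \<open>[]\<close>;
  \<open>False\<close> stands for a step to the left child, \<open>True\<close> for a step to the right child.
\<close>

fun internal_nodes :: "'k full_tree \<Rightarrow> bool list set" where
  "internal_nodes (Leaf i) = {}"
| "internal_nodes (Node l r) =
     insert [] ((#) False ` internal_nodes l \<union> (#) True ` internal_nodes r)"

text \<open>The last equation only concerns paths that leave the tree; its value is irrelevant.\<close>

fun subtree_at :: "'k full_tree \<Rightarrow> bool list \<Rightarrow> 'k full_tree" where
  "subtree_at T [] = T"
| "subtree_at (Node l r) (d # v) = subtree_at (if d then r else l) v"
| "subtree_at (Leaf i) (d # v) = Leaf i"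

definition leaves_below :: "'k full_tree \<Rightarrow> bool list \<Rightarrow> 'k set" where
  "leaves_below T v = set (leaf_list (subtree_at T v))"

definition leaf_vec :: "'k::finite full_tree \<Rightarrow> bool list \<Rightarrow> real ^ 'k" where
  "leaf_vec T v = (\<chi> i. indicator (leaves_below T v) i)"

text \<open>The matrix $x y^\top$.\<close>

definition outer_product :: "real ^ 'k \<Rightarrow> real ^ 'k \<Rightarrow> real ^ 'k ^ 'k" where
  "outer_product x y = (\<chi> i j. x $ i * y $ j)"

definition tree_matrix :: "'k::finite full_tree \<Rightarrow> real ^ 'k ^ 'k" where
  "tree_matrix T = (\<Sum>v\<in>internal_nodes T. outer_product (leaf_vec T v) (leaf_vec T v))"

definition node_mass :: "'k::finite full_tree \<Rightarrow> real ^ 'k \<Rightarrow> bool list \<Rightarrow> real" where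
  "node_mass T p v = (\<Sum>i\<in>leaves_below T v. p $ i)"

definition frobenius_inner :: "real ^ 'k::finite ^ 'k \<Rightarrow> real ^ 'k ^ 'k \<Rightarrow> real" where
  "frobenius_inner X Y = trace (transpose X ** Y)"

text \<open>
  The expectation of a random matrix is taken entrywise. An entry is meaningful only if the
  corresponding product is integrable, since the Bochner integral is \<open>0\<close> otherwise.
\<close>

definition second_moment_matrix :: "'w measure \<Rightarrow> ('w \<Rightarrow> real ^ 'k) \<Rightarrow> real ^ 'k ^ 'k" where
  "second_moment_matrix P X =
     (\<chi> i j. integral\<^sup>L P (\<lambda>\<omega>. outer_product (X \<omega>) (X \<omega>) $ i $ j))"

definition has_second_moments :: "'w measure \<Rightarrow> ('w \<Rightarrow> real ^ 'k) \<Rightarrow> bool" where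
  "has_second_moments P X \<longleftrightarrow>
     (\<forall>i j. integrable P (\<lambda>\<omega>. outer_product (X \<omega>) (X \<omega>) $ i $ j))"

end

theory Submission
  imports Defs
begin

text \<open>Write b_v for \<open>leaf_vec T v\<close>, q_v for \<open>node_mass T p v\<close> and K
  for \<open>tree_matrix T\<close>. Since q_v is the inner product of b_v and p, its square is p^T
  (b_v b_v^T) p, and summing over the internal nodes gives p^T K p. Entrywise this is the double sum
  of K_ij p_i p_j (\<open>sum_node_mass_sq\<close>), a finite combination of the entries of p p^T
  with constant coefficients. Expectation therefore acts entrywise and turns p_i p_j into M_ij; what
  results is the Frobenius inner product of K and M (\<open>frobenius_inner_eq_sum\<close>), which
  is tr(K M) because K is symmetric.\<close>

lemma finite_internal_nodes: "finite (internal_nodes T)"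
  by (induction T) auto

lemma node_mass_eq_inner: "node_mass T p v = leaf_vec T v \<bullet> p"
proof -
  have "leaf_vec T v \<bullet> p = (\<Sum>i\<in>UNIV. if i \<in> leaves_below T v then p $ i else 0)"
    unfolding inner_vec_def leaf_vec_def by (intro sum.cong) auto
  then show ?thesis
    by (simp add: node_mass_def sum.If_cases)
qed

lemma tree_matrix_nth:
  "tree_matrix T $ i $ j = (\<Sum>v\<in>internal_nodes T. leaf_vec T v $ i * leaf_vec T v $ j)"
  by (simp add: tree_matrix_def outer_product_def)

text \<open>A product of two 0/1 indicators is the indicator of the conjunction, so the sum over
  nodes is a count.\<close>

lemma tree_matrix_nth_card:
  "tree_matrix T $ i $ j =
     real (card {v \<in> internal_nodes T. i \<in> leaves_below T v \<and> j \<in> leaves_below T v})"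
proof -
  have "tree_matrix T $ i $ j =
      (\<Sum>v\<in>internal_nodes T. if i \<in> leaves_below T v \<and> j \<in> leaves_below T v then 1 else 0)"
    unfolding tree_matrix_nth by (intro sum.cong) (auto simp: leaf_vec_def)
  then show ?thesis
    by (simp add: sum.If_cases finite_internal_nodes Int_def)
qed

lemma tree_matrix_sym: "tree_matrix T $ i $ j = tree_matrix T $ j $ i"
  by (simp add: tree_matrix_nth mult.commute)

text \<open>Expanding each square and collecting the coefficient of p_i p_j over all nodes yields
  K_ij. This form serves both the quadratic-form identity and the expectation.\<close>

lemma sum_node_mass_sq:
  "(\<Sum>v\<in>internal_nodes T. (node_mass T p v)\<^sup>2) =
     (\<Sum>i\<in>UNIV. \<Sum>j\<in>UNIV. tree_matrix T $ i $ j * outer_product p p $ i $ j)"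
proof -
  have "(\<Sum>v\<in>internal_nodes T. (node_mass T p v)\<^sup>2) =
      (\<Sum>v\<in>internal_nodes T. \<Sum>i\<in>UNIV. \<Sum>j\<in>UNIV.
        leaf_vec T v $ i * leaf_vec T v $ j * outer_product p p $ i $ j)"
    by (simp add: node_mass_eq_inner inner_vec_def power2_eq_square sum_product
        outer_product_def mult_ac)
  also have "\<dots> = (\<Sum>i\<in>UNIV. \<Sum>j\<in>UNIV. \<Sum>v\<in>internal_nodes T.
        leaf_vec T v $ i * leaf_vec T v $ j * outer_product p p $ i $ j)"
    \<comment> \<open>The sum over v moves inwards in two exchanges, first past i, then past
      j.\<close>
    by (subst sum.swap, intro sum.cong refl, rule sum.swap)
  finally show ?thesis
    by (simp add: tree_matrix_nth sum_distrib_right)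
qed

lemma inner_matrix_vector_mult:
  "p \<bullet> (A *v p) = (\<Sum>i\<in>UNIV. \<Sum>j\<in>UNIV. A $ i $ j * outer_product p p $ i $ j)"
  by (simp add: inner_vec_def matrix_vector_mult_def outer_product_def sum_distrib_left mult_ac)

text \<open>The trace of A^T B runs over columns outside and rows inside, so one exchange of sums
  suffices.\<close>

lemma frobenius_inner_eq_sum:
  "frobenius_inner A B = (\<Sum>i\<in>UNIV. \<Sum>j\<in>UNIV. A $ i $ j * B $ i $ j)"
  unfolding frobenius_inner_def trace_def matrix_matrix_mult_def transpose_def
  by simp (rule sum.swap)

lemma trace_tree_matrix_mult:
  "trace (tree_matrix T ** B) = frobenius_inner (tree_matrix T) B"
proof -
  have "transpose (tree_matrix T) = tree_matrix T"
    by (simp add: transpose_def vec_eq_iff) (metis tree_matrix_sym)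
  then show ?thesis
    by (simp add: frobenius_inner_def)
qed

lemma has_second_momentsD:
  assumes "has_second_moments P X"
  shows "integrable P (\<lambda>\<omega>. outer_product (X \<omega>) (X \<omega>) $ i $ j)"
  using assms by (simp add: has_second_moments_def)

theorem proposition2p4:
  fixes T :: "'k::finite full_tree"
  assumes "leaf_indexed T"
  shows
    "(\<forall>i j. tree_matrix T $ i $ j =
        real (card {v \<in> internal_nodes T. i \<in> leaves_below T v \<and> j \<in> leaves_below T v})) \<and>
     (\<forall>p :: real ^ 'k.
        (\<Sum>v\<in>internal_nodes T. (node_mass T p v)\<^sup>2) = p \<bullet> (tree_matrix T *v p)) \<and>
     (\<forall>(P :: 'w measure) (X :: 'w \<Rightarrow> real ^ 'k).
        prob_space P \<longrightarrow> X \<in> borel_measurable P \<longrightarrow> has_second_moments P X \<longrightarrow>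
          integrable P (\<lambda>\<omega>. \<Sum>v\<in>internal_nodes T. (node_mass T (X \<omega>) v)\<^sup>2) \<and>
          integral\<^sup>L P (\<lambda>\<omega>. \<Sum>v\<in>internal_nodes T. (node_mass T (X \<omega>) v)\<^sup>2) =
            trace (tree_matrix T ** second_moment_matrix P X) \<and>
          trace (tree_matrix T ** second_moment_matrix P X) =
            frobenius_inner (tree_matrix T) (second_moment_matrix P X))"
proof (intro conjI allI impI)
  fix i j
  show "tree_matrix T $ i $ j =
      real (card {v \<in> internal_nodes T. i \<in> leaves_below T v \<and> j \<in> leaves_below T v})"
    by (rule tree_matrix_nth_card)
next
  fix p :: "real ^ 'k"
  show "(\<Sum>v\<in>internal_nodes T. (node_mass T p v)\<^sup>2) = p \<bullet> (tree_matrix T *v p)"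
    by (simp only: sum_node_mass_sq inner_matrix_vector_mult)
next
  fix P :: "'w measure" and X :: "'w \<Rightarrow> real ^ 'k"
  assume "has_second_moments P X"
  \<comment> \<open>Integrability of every X_i X_j discharges the side conditions under which the
    integral commutes with finite sums and constant factors.\<close>
  note [simp] = has_second_momentsD[OF this]
  show "integrable P (\<lambda>\<omega>. \<Sum>v\<in>internal_nodes T. (node_mass T (X \<omega>) v)\<^sup>2)"
    by (simp add: sum_node_mass_sq)
  show "integral\<^sup>L P (\<lambda>\<omega>. \<Sum>v\<in>internal_nodes T. (node_mass T (X \<omega>) v)\<^sup>2) =
      trace (tree_matrix T ** second_moment_matrix P X)"
    by (simp add: sum_node_mass_sq trace_tree_matrix_mult frobenius_inner_eq_sum
        second_moment_matrix_def)
  show "trace (tree_matrix T ** second_moment_matrix P X) =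
      frobenius_inner (tree_matrix T) (second_moment_matrix P X)"
    by (rule trace_tree_matrix_mult)
qed

end
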